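(* Let $\Sigma=(\widetilde{\mathbf{x}},\Lambda,\widetilde{B})$ be an acyclic quantum seed with principal coefficients, with indices ordered so that $b_{ij}\ge 0$ for all $n\ge i>j\ge 1$. For any $k\in[1,n]$ and $l\in\mathbb{N}$ we have $$(x_k^{(n)})^l x_k-x_k(x_k^{(n)})^l=f_{k,l}^{(k)},$$ where $$f_{k,l}^{(k)}=g_{k,k,l}\prod_{j\in[k+1,2n]}x_j^{b_{jk}}\cdot\prod_{j\in[1,k-1]}(x_j^{(n)})^{-b_{jk}}\cdot(x_k^{(n)})^{l-1}$$ for some $g_{k,k,l}\in\mathbb{Z}[q^{\pm\frac12}]$, the products being taken in increasing order of $j$.
   Context: Notation: $[s,t]=\{s,s+1,\dots,t\}$; $\mathbb{N}$ includes $0$; $[x]_+=\max(x,0)$, applied entrywise to vectors; $\mathbf{e}_i$ is the $i$-th unit vector. Quantum seeds. Let $\widetilde{B}=(b_{ij})$ be a $2n\times n$ integer matrix with columns $\mathbf{b}_1,\dots,\mathbf{b}_n$, whose upper $n\times n$ part $B$ is skew-symmetrizable: $DB$ is skew-symmetric for $D=\mathrm{diag}(d_1,\dots,d_n)$ with positive integer $d_j$. "Principal coefficients" means that the lower $n\times n$ part of $\widetilde{B}$ is the identity, i.e. $b_{n+i,j}=\delta_{ij}$. Let $\Lambda=(\lambda_{ij})$ be a skew-symmetric $2n\times 2n$ integer matrix, identified with the bilinear form on $\mathbb{Z}^{2n}$ with $\Lambda(\mathbf{e}_i,\mathbf{e}_j)=\lambda_{ij}$, compatible with $\widetilde{B}$: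 $\Lambda(\mathbf{b}_j,\mathbf{e}_i)=\delta_{ij}d_j$ for $i\in[1,2n]$, $j\in[1,n]$. The quantum torus $\mathcal{T}$ is the $\mathbb{Z}[q^{\pm 1/2}]$-algebra with basis $\{X^{\mathbf{a}}:\mathbf{a}\in\mathbb{Z}^{2n}\}$ and product $X^{\mathbf{a}}X^{\mathbf{c}}=q^{\Lambda(\mathbf{a},\mathbf{c})/2}X^{\mathbf{a}+\mathbf{c}}$; $\mathcal{F}$ is its skew-field of fractions, in which all identities take place, and $x_i=X^{\mathbf{e}_i}$, so $x_ix_j=q^{\lambda_{ij}}x_jx_i$ and $X^{\mathbf{a}}=q^{\frac12\sum_{l<k}a_ka_l\lambda_{kl}}x_1^{a_1}\cdots x_{2n}^{a_{2n}}$. The triple $\Sigma=(\widetilde{\mathbf{x}},\Lambda,\widetilde{B})$ with $\widetilde{\mathbf{x}}=\{x_1,\dots,x_{2n}\}$ is a quantum seed. Mutation. For $k\in[1,n]$, the mutation $\mu_k$ replaces $x_k$ by $x_k'=X^{-\mathbf{e}_k+[\mathbf{b}_k]_+}+X^{-\mathbf{e}_k+[-\mathbf{b}_k]_+}$, replaces $\widetilde{B}$ by $\widetilde{B}'$ with $b'_{ij}=-b_{ij}$ if $i=k$ or $j=k$, and $b'_{ij}=b_{ij}+\frac{|b_{ik}|b_{kj}+b_{ik}|b_{kj}|}{2}$ otherwise, and replaces $\Lambda$ by the skew-symmetric $\Lambda'$ with $\lambda'_{ij}=\lambda_{ij}$ for $i,j\ne k$ and $\lambda'_{kj}=-\lambda_{kj}+\sum_{t}[b_{tk}]_+\lambda_{tj}$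 for $j\neq k$. The same rule applies to any seed obtained by mutation, with $X^{\mathbf{a}}$ formed from the variables and form of that seed by the normalized ordered monomial formula above. A seed is acyclic if the directed graph on $[1,n]$ with an edge $i\to j$ whenever $b_{ij}>0$ has no oriented cycle; in this case, after reordering, one assumes $b_{ij}\ge0$ for all $i>j$ in $[1,n]$ (so $b_{ij}\le0$ for $i<j$ in $[1,n]$). Projective cluster variables. For $i\in[1,n]$ put $\Sigma^{(i)}=(\widetilde{\mathbf{x}}^{(i)},\Lambda^{(i)},\widetilde{B}^{(i)})=\mu_i\cdots\mu_2\mu_1(\Sigma)$ ($\mu_1$ is applied first), with $\widetilde{\mathbf{x}}^{(i)}=\{x_1^{(i)},\dots,x_{2n}^{(i)}\}$. The elements $x_1^{(n)},\dots,x_n^{(n)}$ of the cluster of $\Sigma^{(n)}$ are the quantum projective cluster variables. *)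

theory Defs
  imports Main
begin

text \<open>
  Integer matrices and exponent vectors are functions on natural numbers, used only at the
  1-based indices \<open>1, \<dots>, 2n\<close>.  The skew-field \<open>\<F>\<close> is the type \<open>'a\<close> of class
  \<^class>\<open>division_ring\<close>, and \<open>qh\<close> stands for \<open>q\<close> to the power \<open>1/2\<close>, so that
  \<open>q\<close> to the power \<open>m/2\<close> is \<open>qh powi m\<close>.
\<close>

section \<open>The quantum torus and its skew-field of fractions\<close>

definition expvecs :: "nat \<Rightarrow> (nat \<Rightarrow> int) set" where
  "expvecs n = {a. \<forall>i. i \<notin> {1..2 * n} \<longrightarrow> a i = 0}"

definition unitvec :: "nat \<Rightarrow> nat \<Rightarrow> int" where
  "unitvec i = (\<lambda>j. if j = i then 1 else 0)"

definition bilin :: "nat \<Rightarrow> (nat \<Rightarrow> nat \<Rightarrow> int) \<Rightarrow> (nat \<Rightarrow> int) \<Rightarrow> (nat \<Rightarrow> int) \<Rightarrow> int" where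
  "bilin n \<Lambda> a c = (\<Sum>i\<in>{1..2 * n}. \<Sum>j\<in>{1..2 * n}. a i * c j * \<Lambda> i j)"

definition laurent_ring :: "'a::division_ring \<Rightarrow> 'a set" where
  "laurent_ring qh = {(\<Sum>m\<in>M. of_int (c m) * qh powi m) | (M :: int set) (c :: int \<Rightarrow> int). finite M}"

definition torus :: "nat \<Rightarrow> 'a::division_ring \<Rightarrow> ((nat \<Rightarrow> int) \<Rightarrow> 'a) \<Rightarrow> 'a set" where
  "torus n qh X = {(\<Sum>a\<in>A. f a * X a) | A f.
     finite A \<and> A \<subseteq> expvecs n \<and> (\<forall>a\<in>A. f a \<in> laurent_ring qh)}"

text \<open>
  The skew-field of fractions is determined up to isomorphism by the following conditions.
  By \<open>transcendental\<close>, the set \<^term>\<open>laurent_ring qh\<close> is a genuine Laurent polynomial ring over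
  the integers; by \<open>independent\<close> and \<open>mult\<close>, the set \<^term>\<open>torus n qh X\<close> is the quantum torus
  with basis \<open>X a\<close> (the identity \<open>X 0 = 1\<close> follows).
\<close>

locale quantum_torus_fractions =
  fixes n :: nat
    and \<Lambda> :: "nat \<Rightarrow> nat \<Rightarrow> int"
    and qh :: "'a::division_ring"
    and X :: "(nat \<Rightarrow> int) \<Rightarrow> 'a"
  assumes qh_nonzero: "qh \<noteq> 0"
    and central: "\<And>z. qh * z = z * qh"
    and transcendental: "\<And>(M :: int set) (c :: int \<Rightarrow> int). finite M \<Longrightarrow>
          (\<Sum>m\<in>M. of_int (c m) * qh powi m) = 0 \<Longrightarrow> \<forall>m\<in>M. c m = 0"
    and independent: "\<And>A f. finite A \<Longrightarrow> A \<subseteq> expvecs n \<Longrightarrow> \<forall>a\<in>A. f a \<in> laurent_ring qh \<Longrightarrow>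
          (\<Sum>a\<in>A. f a * X a) = 0 \<Longrightarrow> \<forall>a\<in>A. f a = 0"
    and mult: "\<And>a c. a \<in> expvecs n \<Longrightarrow> c \<in> expvecs n \<Longrightarrow>
          X a * X c = qh powi (bilin n \<Lambda> a c) * X (\<lambda>i. a i + c i)"
    and fractions: "\<And>z. \<exists>u\<in>torus n qh X. \<exists>v\<in>torus n qh X. v \<noteq> 0 \<and> z = u * inverse v"

section \<open>Quantum seeds\<close>

record 'a qseed =
  vars :: "nat \<Rightarrow> 'a"
  form :: "nat \<Rightarrow> nat \<Rightarrow> int"
  bmat :: "nat \<Rightarrow> nat \<Rightarrow> int"

definition skew_symmetrizable_by :: "nat \<Rightarrow> (nat \<Rightarrow> int) \<Rightarrow> (nat \<Rightarrow> nat \<Rightarrow> int) \<Rightarrow> bool" where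
  "skew_symmetrizable_by n d b \<longleftrightarrow>
     (\<forall>j\<in>{1..n}. d j > 0) \<and> (\<forall>i\<in>{1..n}. \<forall>j\<in>{1..n}. d i * b i j = - (d j * b j i))"

definition skew_symmetric :: "nat \<Rightarrow> (nat \<Rightarrow> nat \<Rightarrow> int) \<Rightarrow> bool" where
  "skew_symmetric n \<Lambda> \<longleftrightarrow> (\<forall>i\<in>{1..2 * n}. \<forall>j\<in>{1..2 * n}. \<Lambda> i j = - \<Lambda> j i)"

definition compatible :: "nat \<Rightarrow> (nat \<Rightarrow> int) \<Rightarrow> (nat \<Rightarrow> nat \<Rightarrow> int) \<Rightarrow> (nat \<Rightarrow> nat \<Rightarrow> int) \<Rightarrow> bool" where
  "compatible n d \<Lambda> b \<longleftrightarrow>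
     (\<forall>i\<in>{1..2 * n}. \<forall>j\<in>{1..n}.
        bilin n \<Lambda> (\<lambda>t. b t j) (unitvec i) = (if i = j then d j else 0))"

definition quantum_seed ::
    "nat \<Rightarrow> (nat \<Rightarrow> int) \<Rightarrow> 'a::division_ring \<Rightarrow> ((nat \<Rightarrow> int) \<Rightarrow> 'a) \<Rightarrow> 'a qseed \<Rightarrow> bool" where
  "quantum_seed n d qh X S \<longleftrightarrow>
     skew_symmetrizable_by n d (bmat S) \<and>
     skew_symmetric n (form S) \<and>
     compatible n d (form S) (bmat S) \<and>
     quantum_torus_fractions n (form S) qh X \<and>
     (\<forall>i\<in>{1..2 * n}. vars S i = X (unitvec i))"

definition principal_coefficients :: "nat \<Rightarrow> 'a qseed \<Rightarrow> bool" where
  "principal_coefficients n S \<longleftrightarrow>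
     (\<forall>i\<in>{1..n}. \<forall>j\<in>{1..n}. bmat S (n + i) j = (if i = j then 1 else 0))"

definition acyclic_seed :: "nat \<Rightarrow> 'a qseed \<Rightarrow> bool" where
  "acyclic_seed n S \<longleftrightarrow> acyclic {(i, j). i \<in> {1..n} \<and> j \<in> {1..n} \<and> bmat S i j > 0}"

section \<open>Mutation\<close>

definition ordered_prod :: "(nat \<Rightarrow> 'a::monoid_mult) \<Rightarrow> nat \<Rightarrow> nat \<Rightarrow> 'a" where
  "ordered_prod f i j = prod_list (map f [i..<Suc j])"

definition normalized_monomial ::
    "nat \<Rightarrow> 'a::division_ring \<Rightarrow> 'a qseed \<Rightarrow> (nat \<Rightarrow> int) \<Rightarrow> 'a" where
  "normalized_monomial n qh S a =
     qh powi (\<Sum>k\<in>{1..2 * n}. \<Sum>l\<in>{1..<k}. a k * a l * form S k l) *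
     ordered_prod (\<lambda>i. vars S i powi a i) 1 (2 * n)"

definition mutate_vars :: "nat \<Rightarrow> 'a::division_ring \<Rightarrow> nat \<Rightarrow> 'a qseed \<Rightarrow> nat \<Rightarrow> 'a" where
  "mutate_vars n qh k S = (vars S)(k :=
     normalized_monomial n qh S (\<lambda>i. - unitvec k i + max (bmat S i k) 0) +
     normalized_monomial n qh S (\<lambda>i. - unitvec k i + max (- bmat S i k) 0))"

definition mutate_row :: "nat \<Rightarrow> nat \<Rightarrow> 'a qseed \<Rightarrow> nat \<Rightarrow> int" where
  "mutate_row n k S j = - form S k j + (\<Sum>t\<in>{1..2 * n}. max (bmat S t k) 0 * form S t j)"

definition mutate_form :: "nat \<Rightarrow> nat \<Rightarrow> 'a qseed \<Rightarrow> nat \<Rightarrow> nat \<Rightarrow> int" where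
  "mutate_form n k S i j =
     (if i = k \<and> j = k then 0
      else if i = k then mutate_row n k S j
      else if j = k then - mutate_row n k S i
      else form S i j)"

text \<open>The integer division by \<open>2\<close> below is exact.\<close>

definition mutate_bmat :: "nat \<Rightarrow> 'a qseed \<Rightarrow> nat \<Rightarrow> nat \<Rightarrow> int" where
  "mutate_bmat k S i j =
     (let b = bmat S in
      if i = k \<or> j = k then - b i j
      else b i j + (\<bar>b i k\<bar> * b k j + b i k * \<bar>b k j\<bar>) div 2)"

definition mutate :: "nat \<Rightarrow> 'a::division_ring \<Rightarrow> nat \<Rightarrow> 'a qseed \<Rightarrow> 'a qseed" where
  "mutate n qh k S =
     \<lparr>vars = mutate_vars n qh k S, form = mutate_form n k S, bmat = mutate_bmat k S\<rparr>"

definition iterated_seed :: "nat \<Rightarrow> 'a::division_ring \<Rightarrow> 'a qseed \<Rightarrow> nat \<Rightarrow> 'a qseed" where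
  "iterated_seed n qh S i = fold (mutate n qh) [1..<Suc i] S"

definition projective_var :: "nat \<Rightarrow> 'a::division_ring \<Rightarrow> 'a qseed \<Rightarrow> nat \<Rightarrow> 'a" where
  "projective_var n qh S = vars (iterated_seed n qh S n)"

end

theory Submission
  imports Defs
begin

text \<open>
  In the chosen order, every step of the mutation sequence \<open>1, 2, \<dots>, n\<close> takes place at a vertex
  \<open>k\<close> whose column in the current extended matrix is nonnegative and whose row is nonpositive.
  At such a vertex the correction term of matrix mutation vanishes, and compatibility makes the
  sum in the mutation of the form collapse as well.  Hence the matrix and the form only change
  signs, in the \<open>k\<close>-th row and column (\<open>bmat_mutate_sink\<close>, \<open>form_mutate_sink\<close>); compatibility
  is inherited, and the exponents of the next column can be read off from the initial matrix.

  At a vertex of this kind the exchange relation is \<open>y = inverse x + P\<close>, where \<open>P\<close> is a monomial.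
  All monomials of one cluster commute up to powers of \<open>qh\<close>, and compatibility says that the
  power is \<open>qh powi (2 * d k)\<close> for \<open>P\<close> and \<open>x\<close>, and that \<open>P\<close> and \<open>inverse x\<close> pick up the same
  power against every other variable.  The second fact carries the quasi-commutation over to the
  new cluster (\<open>q_commutes_mutate_sink\<close>).  The first fact yields the formula: with
  \<open>W = P * x\<close> and \<open>m = 2 * d k\<close> one has \<open>y * x = 1 + W\<close> and
  \<open>x * y = 1 + qh powi (- m) * W\<close>, while \<open>y\<close> commutes with \<open>W\<close> up to the factor \<open>qh powi m\<close>, so
  that the commutator of a power of \<open>y\<close> with \<open>x\<close> is a scalar times \<open>W\<close> times a lower power of \<open>y\<close>
  (\<open>commutator_exchange\<close>).  Finally, \<open>W\<close> is the product of the remaining factors of \<open>P\<close> once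
  \<open>inverse x\<close> has been moved past them, and these factors can be rearranged at the cost of
  another power of \<open>qh\<close>.
\<close>

section \<open>Commutation up to a power of a central unit\<close>

definition q_commutes :: "'a::division_ring \<Rightarrow> int \<Rightarrow> 'a \<Rightarrow> 'a \<Rightarrow> bool" where
  "q_commutes qh m u z \<longleftrightarrow> u * z = qh powi m * z * u"

locale central_unit =
  fixes qh :: "'a::division_ring"
  assumes unit_nonzero: "qh \<noteq> 0"
    and unit_central: "\<And>z. qh * z = z * qh"
begin

lemma powi_central: "qh powi m * z = z * qh powi m"
proof -
  have "inverse qh * z = z * inverse qh"
    using unit_central[of "inverse qh * z * inverse qh"] unit_nonzero
    by (simp add: mult.assoc) (simp add: mult.assoc[symmetric])
  then have "u ^ l * z = z * u ^ l" if "u \<in> {qh, inverse qh}" for u l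
    using power_commuting_commutes[of u z l] unit_central that by auto
  then show ?thesis
    by (simp add: power_int_def)
qed

lemma powi_left_commute: "z * (qh powi m * w) = qh powi m * (z * w)"
  by (metis powi_central mult.assoc)

lemma powi_add: "qh powi (a + b) = qh powi a * qh powi b"
  using unit_nonzero by (simp add: power_int_add)

lemma powi_add_assoc: "qh powi a * (qh powi b * z) = qh powi (a + b) * z"
  by (simp add: powi_add mult.assoc)

lemma q_commutes_unit: "q_commutes qh 0 (qh powi a) z"
  by (simp add: q_commutes_def powi_central)

lemma q_commutes_one: "q_commutes qh 0 1 z"
  by (simp add: q_commutes_def)

lemma q_commutes_mult:
  assumes "q_commutes qh a u z" "q_commutes qh b v z"
  shows "q_commutes qh (a + b) (u * v) z"
proof -
  have "u * v * z = u * (qh powi b * z * v)"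
    using assms(2) by (simp add: q_commutes_def mult.assoc)
  also have "\<dots> = qh powi b * (u * z) * v"
    by (simp add: mult.assoc powi_left_commute)
  also have "\<dots> = qh powi (a + b) * z * (u * v)"
    using assms(1) by (simp add: q_commutes_def mult.assoc powi_add_assoc add.commute)
  finally show ?thesis
    by (simp add: q_commutes_def)
qed

lemma q_commutes_add:
  assumes "q_commutes qh a u z" "q_commutes qh a v z"
  shows "q_commutes qh a (u + v) z"
  using assms by (simp add: q_commutes_def algebra_simps)

lemma q_commutes_sym:
  assumes "q_commutes qh a u z"
  shows "q_commutes qh (- a) z u"
  using assms unit_nonzero
  by (simp add: q_commutes_def mult.assoc powi_add_assoc)

lemma q_commutes_inverse:
  assumes "q_commutes qh a u z"
  shows "q_commutes qh (- a) (inverse u) z"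
proof (cases "u = 0")
  case False
  have "qh powi (- a) * z * inverse u = inverse u * u * (qh powi (- a) * z * inverse u)"
    using False by simp
  also have "\<dots> = inverse u * (qh powi (- a) * (u * z * inverse u))"
    by (simp only: powi_left_commute mult.assoc)
  also have "u * z * inverse u = qh powi a * z"
    using assms False by (simp add: q_commutes_def mult.assoc)
  also have "inverse u * (qh powi (- a) * (qh powi a * z)) = inverse u * z"
    by (simp only: powi_add_assoc) simp
  finally show ?thesis
    by (simp add: q_commutes_def)
qed (simp add: q_commutes_def)

lemma q_commutes_power:
  assumes "q_commutes qh a u z"
  shows "q_commutes qh (int l * a) (u ^ l) z"
proof (induction l)
  case (Suc l)
  then show ?case
    using q_commutes_mult[OF assms Suc] by (simp add: algebra_simps)
qed (simp add: q_commutes_one)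

lemma q_commutes_powi:
  assumes "q_commutes qh a u z"
  shows "q_commutes qh (e * a) (u powi e) z"
proof (cases "e \<ge> 0")
  case True
  then show ?thesis
    using q_commutes_power[OF assms, of "nat e"] by (simp add: power_int_def)
next
  case False
  then show ?thesis
    using q_commutes_power[OF q_commutes_inverse[OF assms], of "nat (- e)"]
    by (simp add: power_int_def)
qed

lemma q_commutes_prod_list:
  assumes "\<And>t. t \<in> set ts \<Longrightarrow> q_commutes qh (m t) (f t) z"
  shows "q_commutes qh (\<Sum>t\<leftarrow>ts. m t) (prod_list (map f ts)) z"
  using assms by (induction ts) (auto simp: q_commutes_one intro!: q_commutes_mult)

lemma q_commutes_ordered_prod:
  assumes "\<And>t. t \<in> {i..j} \<Longrightarrow> q_commutes qh (m t) (f t) z"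
  shows "q_commutes qh (\<Sum>t\<in>{i..j}. m t) (ordered_prod f i j) z"
proof -
  have "(\<Sum>t\<leftarrow>[i..<Suc j]. m t) = (\<Sum>t\<in>{i..j}. m t)"
    by (simp only: interv_sum_list_conv_sum_set_nat set_upt atLeastLessThanSuc_atLeastAtMost)
  moreover have "q_commutes qh (\<Sum>t\<leftarrow>[i..<Suc j]. m t) (prod_list (map f [i..<Suc j])) z"
    by (rule q_commutes_prod_list) (use assms in auto)
  ultimately show ?thesis
    by (simp add: ordered_prod_def)
qed

lemma q_commutes_normalized_monomial:
  assumes "\<And>t. t \<in> {1..2 * n} \<Longrightarrow> q_commutes qh (m t) (vars T t) z"
  shows "q_commutes qh (\<Sum>t\<in>{1..2 * n}. a t * m t) (normalized_monomial n qh T a) z"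
proof -
  have "q_commutes qh (0 + (\<Sum>t\<in>{1..2 * n}. a t * m t)) (normalized_monomial n qh T a) z"
    unfolding normalized_monomial_def
    by (intro q_commutes_mult q_commutes_unit q_commutes_ordered_prod q_commutes_powi assms)
  then show ?thesis
    by simp
qed

text \<open>
  Both summands of \<open>y\<close> have the same commutation factor with \<open>P * x\<close>: for \<open>inverse x\<close> it comes
  from \<open>P\<close>, and for \<open>P\<close> it comes from \<open>x\<close>.  Since \<open>y * x\<close> and \<open>x * y\<close> are \<open>1\<close> plus multiples of
  \<open>P * x\<close>, each of the two products in the commutator is \<open>y ^ l\<close> plus one multiple of
  \<open>P * x * y ^ l\<close>, and the terms \<open>y ^ l\<close> cancel.
\<close>

lemma commutator_exchange:
  assumes "x \<noteq> 0" and Px: "q_commutes qh m P x" and y: "y = inverse x + P"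
  shows "y ^ Suc l * x - x * y ^ Suc l = (qh powi (int l * m) - qh powi (- m)) * (P * x) * y ^ l"
proof -
  define W where "W = P * x"
  have self: "q_commutes qh 0 u u" for u
    by (simp add: q_commutes_def)
  have xP: "q_commutes qh (- m) x P"
    by (rule q_commutes_sym) (rule Px)
  have "q_commutes qh (- m) x W"
    using q_commutes_sym[OF q_commutes_mult[OF Px self]] by (simp add: W_def)
  then have "q_commutes qh m (inverse x) W"
    using q_commutes_inverse by fastforce
  moreover have "q_commutes qh m P W"
    using q_commutes_sym[OF q_commutes_mult[OF self xP]] by (simp add: W_def)
  ultimately have "q_commutes qh m y W"
    unfolding y by (rule q_commutes_add)
  then have yW: "y ^ l * W = qh powi (int l * m) * W * y ^ l"
    using q_commutes_power by (auto simp: q_commutes_def)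
  have yx: "y * x = 1 + W"
    using \<open>x \<noteq> 0\<close> by (simp add: y W_def algebra_simps)
  have xy: "x * y = 1 + qh powi (- m) * W"
    using \<open>x \<noteq> 0\<close> xP by (simp add: y W_def algebra_simps q_commutes_def)
  have "y ^ Suc l * x = y ^ l * (y * x)"
    by (simp only: power_Suc2 mult.assoc)
  also have "\<dots> = y ^ l + qh powi (int l * m) * W * y ^ l"
    by (simp add: yx yW algebra_simps)
  finally have "y ^ Suc l * x = y ^ l + qh powi (int l * m) * W * y ^ l" .
  moreover have "x * y ^ Suc l = y ^ l + qh powi (- m) * W * y ^ l"
    by (simp add: xy mult.assoc[symmetric] distrib_right del: power_int_minus)
  ultimately show ?thesis
    by (simp add: W_def left_diff_distrib)
qed

end

lemma powi_diff_in_laurent_ring: "qh powi a - qh powi b \<in> laurent_ring qh"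
proof (cases "a = b")
  case True
  then show ?thesis
    by (auto simp: laurent_ring_def intro!: exI[of _ "{}"])
next
  case False
  define c :: "int \<Rightarrow> int" where "c = (\<lambda>m. if m = a then 1 else - 1)"
  have "qh powi a - qh powi b = (\<Sum>m\<in>{a, b}. of_int (c m) * qh powi m)"
    using False by (simp add: c_def)
  then show ?thesis
    unfolding laurent_ring_def by blast
qed

lemma one_in_laurent_ring: "1 \<in> laurent_ring qh"
  by (auto simp: laurent_ring_def intro!: exI[of _ "{0}"] exI[of _ "\<lambda>_. 1"])

lemma bilin_unitvec:
  assumes "j \<in> {1..2 * n}"
  shows "bilin n \<Lambda> a (unitvec j) = (\<Sum>t\<in>{1..2 * n}. a t * \<Lambda> t j)"
proof -
  have "(\<Sum>i\<in>{1..2 * n}. a t * unitvec j i * \<Lambda> t i) = a t * \<Lambda> t j" for t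
  proof -
    have "(\<Sum>i\<in>{1..2 * n}. a t * unitvec j i * \<Lambda> t i)
        = (\<Sum>i\<in>{1..2 * n}. if i = j then a t * \<Lambda> t i else 0)"
      by (rule sum.cong) (auto simp: unitvec_def)
    then show ?thesis
      using assms by simp
  qed
  then show ?thesis
    by (simp add: bilin_def)
qed

lemma sum_unitvec:
  assumes "k \<in> {1..2 * n}"
  shows "(\<Sum>t\<in>{1..2 * n}. unitvec k t * f t) = f k"
proof -
  have "(\<Sum>t\<in>{1..2 * n}. unitvec k t * f t) = (\<Sum>t\<in>{1..2 * n}. if t = k then f t else 0)"
    by (rule sum.cong) (auto simp: unitvec_def)
  then show ?thesis
    using assms by simp
qed

lemma prod_list_neutral: "(\<And>t. t \<in> set ts \<Longrightarrow> f t = 1) \<Longrightarrow> prod_list (map f ts) = 1"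
  for f :: "'b \<Rightarrow> 'a::monoid_mult"
  by (induction ts) auto

lemma ordered_prod_cong:
  assumes "\<And>t. t \<in> {i..j} \<Longrightarrow> f t = g t"
  shows "ordered_prod f i j = ordered_prod g i j"
  unfolding ordered_prod_def by (intro arg_cong[of _ _ prod_list] map_cong) (use assms in auto)

lemma ordered_prod_neutral:
  assumes "\<And>t. t \<in> {i..j} \<Longrightarrow> f t = 1"
  shows "ordered_prod f i j = 1"
  unfolding ordered_prod_def by (rule prod_list_neutral) (use assms in auto)

lemma ordered_prod_split:
  assumes "i \<le> k" "k \<le> j" "1 \<le> k"
  shows "ordered_prod f i j = ordered_prod f i (k - 1) * f k * ordered_prod f (k + 1) j"
proof -
  have "[i..<Suc j] = [i..<k] @ [k..<Suc j]"
    using upt_add_eq_append[of i k "Suc j - k"] assms by simp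
  also have "[k..<Suc j] = k # [k + 1..<Suc j]"
    using assms by (simp add: upt_conv_Cons)
  finally show ?thesis
    using assms by (simp add: ordered_prod_def mult.assoc)
qed

section \<open>Mutation at a sink\<close>

text \<open>
  The integer \<open>d\<close> is the entry of the symmetrizer at \<open>k\<close>.  Compatibility is written out as a sum
  over the \<open>k\<close>-th column, the form in which it meets the exponents of the exchange monomial.
\<close>

locale sink_seed = central_unit qh for qh :: "'a::division_ring" +
  fixes n k :: nat and d :: int and T :: "'a qseed"
  assumes k: "k \<in> {1..n}"
    and column_nonneg: "\<And>t. t \<in> {1..2 * n} \<Longrightarrow> bmat T t k \<ge> 0"
    and row_nonpos: "\<And>j. j \<in> {1..n} \<Longrightarrow> bmat T k j \<le> 0"
    and skew: "skew_symmetric n (form T)"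
    and column_compatible: "\<And>j. j \<in> {1..2 * n} \<Longrightarrow>
          (\<Sum>t\<in>{1..2 * n}. bmat T t k * form T t j) = (if j = k then d else 0)"
    and vars_q_commute: "\<And>i j. i \<in> {1..2 * n} \<Longrightarrow> j \<in> {1..2 * n} \<Longrightarrow>
          q_commutes qh (2 * form T i j) (vars T i) (vars T j)"
begin

lemma k_le: "k \<in> {1..2 * n}"
  using k by auto

lemma diagonal_zero: "bmat T k k = 0"
  using column_nonneg[OF k_le] row_nonpos[OF k] by simp

lemma form_skew: "i \<in> {1..2 * n} \<Longrightarrow> j \<in> {1..2 * n} \<Longrightarrow> form T i j = - form T j i"
  using skew unfolding skew_symmetric_def by blast

lemma form_diagonal: "form T k k = 0"
  using form_skew[OF k_le k_le] by simp

definition exchange_monomial :: 'a where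
  "exchange_monomial = normalized_monomial n qh T (\<lambda>i. - unitvec k i + max (bmat T i k) 0)"

text \<open>The second exchange monomial involves only \<open>k\<close>, because the column is nonnegative.\<close>

lemma vars_mutate_sink: "vars (mutate n qh k T) k = inverse (vars T k) + exchange_monomial"
proof -
  let ?a = "\<lambda>i. - unitvec k i + max (- bmat T i k) 0"
  have a: "?a t = (if t = k then - 1 else 0)" if "t \<in> {1..2 * n}" for t
    using column_nonneg[OF that] by (auto simp: unitvec_def)
  have "(\<Sum>u\<in>{1..2 * n}. \<Sum>v\<in>{1..<u}. ?a u * ?a v * form T u v) = 0"
  proof (intro sum.neutral ballI)
    fix u v
    assume "u \<in> {1..2 * n}" "v \<in> {1..<u}"
    then show "?a u * ?a v * form T u v = 0"
      using a[of u] a[of v] by auto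
  qed
  moreover have "ordered_prod (\<lambda>i. vars T i powi ?a i) 1 (2 * n) = inverse (vars T k)"
  proof -
    have "ordered_prod (\<lambda>i. vars T i powi ?a i) 1 (k - 1) = 1"
      by (rule ordered_prod_neutral) (use k a in auto)
    moreover have "ordered_prod (\<lambda>i. vars T i powi ?a i) (k + 1) (2 * n) = 1"
      by (rule ordered_prod_neutral) (use k a in auto)
    moreover have "vars T k powi ?a k = inverse (vars T k)"
      using a[OF k_le] by simp
    ultimately show ?thesis
      using k ordered_prod_split[of 1 k "2 * n" "\<lambda>i. vars T i powi ?a i"] by simp
  qed
  ultimately show ?thesis
    by (simp add: mutate_def mutate_vars_def exchange_monomial_def normalized_monomial_def
        add.commute)
qed

lemma vars_mutate_other: "j \<noteq> k \<Longrightarrow> vars (mutate n qh k T) j = vars T j"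
  by (simp add: mutate_def mutate_vars_def)

lemma bmat_mutate_sink:
  assumes "i \<in> {1..2 * n}" "j \<in> {1..n}"
  shows "bmat (mutate n qh k T) i j
    = (if i = k then - 1 else 1) * (if j = k then - 1 else 1) * bmat T i j"
  using column_nonneg[OF assms(1)] row_nonpos[OF assms(2)] diagonal_zero
  by (auto simp: mutate_def mutate_bmat_def Let_def)

text \<open>
  The sum over the nonnegative \<open>k\<close>-th column is the compatibility pairing of that column with a
  unit vector other than the \<open>k\<close>-th one, hence zero.
\<close>

lemma form_mutate_sink:
  assumes "i \<in> {1..2 * n}" "j \<in> {1..2 * n}"
  shows "form (mutate n qh k T) i j
    = (if i = k then - 1 else 1) * (if j = k then - 1 else 1) * form T i j"
proof -
  have row: "mutate_row n k T j = - form T k j" if "j \<in> {1..2 * n}" "j \<noteq> k" for j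
  proof -
    have "(\<Sum>t\<in>{1..2 * n}. max (bmat T t k) 0 * form T t j)
        = (\<Sum>t\<in>{1..2 * n}. bmat T t k * form T t j)"
      by (rule sum.cong) (use column_nonneg in auto)
    then show ?thesis
      using column_compatible[OF that(1)] that(2) by (simp add: mutate_row_def)
  qed
  have "form T i k = - form T k i"
    by (rule form_skew[OF assms(1) k_le])
  then show ?thesis
    using row assms form_diagonal by (auto simp: mutate_def mutate_form_def)
qed

text \<open>
  The exponent vector is the \<open>k\<close>-th column minus the \<open>k\<close>-th unit vector.  By compatibility the
  column pairs to zero with all unit vectors but the \<open>k\<close>-th, so only the subtracted unit vector
  is seen by the other variables.
\<close>

lemma exchange_monomial_q_commutes:
  assumes "j \<in> {1..2 * n}"
  shows "q_commutes qh (2 * ((if j = k then d else 0) - form T k j)) exchange_monomial (vars T j)"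
proof -
  have "(\<Sum>t\<in>{1..2 * n}. (- unitvec k t + max (bmat T t k) 0) * (2 * form T t j))
      = (\<Sum>t\<in>{1..2 * n}. 2 * (bmat T t k * form T t j) - unitvec k t * (2 * form T t j))"
    by (rule sum.cong) (use column_nonneg in \<open>auto simp: algebra_simps\<close>)
  also have "\<dots> = 2 * ((if j = k then d else 0) - form T k j)"
    by (simp only: sum_subtractf sum_distrib_left[symmetric] column_compatible[OF assms]
        sum_unitvec[OF k_le] right_diff_distrib)
  finally show ?thesis
    using q_commutes_normalized_monomial[where n = n and T = T and z = "vars T j"
        and m = "\<lambda>t. 2 * form T t j" and a = "\<lambda>i. - unitvec k i + max (bmat T i k) 0"]
      vars_q_commute[OF _ assms]
    by (simp only: exchange_monomial_def)
qed

text \<open>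
  Against a variable other than the \<open>k\<close>-th one, both summands of the new variable pick up the
  power of \<open>qh\<close> that belongs to the inverse of the old variable.
\<close>

lemma q_commutes_mutate_sink:
  assumes "i \<in> {1..2 * n}" "j \<in> {1..2 * n}"
  shows "q_commutes qh (2 * form (mutate n qh k T) i j)
    (vars (mutate n qh k T) i) (vars (mutate n qh k T) j)"
proof -
  let ?T = "mutate n qh k T"
  have new: "q_commutes qh (- 2 * form T k j) (vars ?T k) (vars T j)"
    if "j \<in> {1..2 * n}" "j \<noteq> k" for j
    using q_commutes_add[OF q_commutes_inverse[OF vars_q_commute[OF k_le that(1)]], of exchange_monomial]
      exchange_monomial_q_commutes[OF that(1)] that(2)
    by (simp add: vars_mutate_sink)
  have sk: "form T i k = - form T k i"
    by (rule form_skew[OF assms(1) k_le])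
  consider "i = k" "j = k" | "i = k" "j \<noteq> k" | "i \<noteq> k" "j = k" | "i \<noteq> k" "j \<noteq> k"
    by blast
  then show ?thesis
  proof cases
    case 1
    then show ?thesis
      using form_mutate_sink[OF assms] form_diagonal by (simp add: q_commutes_def)
  next
    case 2
    then show ?thesis
      using form_mutate_sink[OF assms] new[OF assms(2)] by (simp add: vars_mutate_other)
  next
    case 3
    then show ?thesis
      using form_mutate_sink[OF assms] q_commutes_sym[OF new[OF assms(1)]] sk
      by (simp add: vars_mutate_other)
  next
    case 4
    then show ?thesis
      using form_mutate_sink[OF assms] vars_q_commute[OF assms] by (simp add: vars_mutate_other)
  qed
qed

text \<open>
  Multiplying the exchange monomial by the old variable removes the factor with exponent \<open>- 1\<close>;
  the order of the two remaining blocks is the one in which the commutator formula is stated.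
\<close>

lemma exchange_monomial_times_var:
  assumes "vars T k \<noteq> 0"
  shows "\<exists>c. exchange_monomial * vars T k = qh powi c *
    (ordered_prod (\<lambda>j. vars T j powi bmat T j k) (k + 1) (2 * n) *
     ordered_prod (\<lambda>j. vars T j powi bmat T j k) 1 (k - 1))"
proof -
  let ?x = "vars T k"
  let ?a = "\<lambda>i. - unitvec k i + max (bmat T i k) 0"
  let ?f = "\<lambda>j. vars T j powi bmat T j k"
  let ?Y = "ordered_prod ?f 1 (k - 1)"
  let ?Z = "ordered_prod ?f (k + 1) (2 * n)"
  have a: "?a t = bmat T t k" if "t \<in> {1..2 * n}" "t \<noteq> k" for t
    using column_nonneg[OF that(1)] that(2) by (auto simp: unitvec_def)
  have "ordered_prod (\<lambda>i. vars T i powi ?a i) 1 (k - 1) = ?Y"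
    by (rule ordered_prod_cong) (use k a in auto)
  moreover have "ordered_prod (\<lambda>i. vars T i powi ?a i) (k + 1) (2 * n) = ?Z"
    by (rule ordered_prod_cong) (use k a in auto)
  moreover have "vars T k powi ?a k = inverse ?x"
    by (simp add: unitvec_def diagonal_zero)
  ultimately have "ordered_prod (\<lambda>i. vars T i powi ?a i) 1 (2 * n) = ?Y * inverse ?x * ?Z"
    using k ordered_prod_split[of 1 k "2 * n" "\<lambda>i. vars T i powi ?a i"] by simp
  then obtain c0 where P: "exchange_monomial = qh powi c0 * (?Y * inverse ?x * ?Z)"
    unfolding exchange_monomial_def normalized_monomial_def by metis
  have Z: "\<exists>m. q_commutes qh m ?Z z"
    if "\<And>t. t \<in> {k + 1..2 * n} \<Longrightarrow> \<exists>m. q_commutes qh m (vars T t) z" for z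
  proof -
    from that obtain m where "q_commutes qh (m t) (vars T t) z" if "t \<in> {k + 1..2 * n}" for t
      by metis
    then show ?thesis
      using q_commutes_ordered_prod[of "k + 1" "2 * n" "\<lambda>t. bmat T t k * m t" ?f z] q_commutes_powi
      by blast
  qed
  have "\<exists>m. q_commutes qh m ?Z ?x"
  proof (rule Z)
    fix t
    assume "t \<in> {k + 1..2 * n}"
    then have "t \<in> {1..2 * n}"
      by simp
    then show "\<exists>m. q_commutes qh m (vars T t) ?x"
      using vars_q_commute[OF _ k_le] by blast
  qed
  then obtain m where m: "q_commutes qh m ?Z ?x" ..
  have "\<exists>m. q_commutes qh m ?Z ?Y"
  proof (rule Z)
    fix t
    assume t: "t \<in> {k + 1..2 * n}"
    have "q_commutes qh (2 * form T j t) (vars T j) (vars T t)" if "j \<in> {1..k - 1}" for j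
      using that t k by (intro vars_q_commute) auto
    then have "q_commutes qh (\<Sum>j\<in>{1..k - 1}. bmat T j k * (2 * form T j t)) ?Y (vars T t)"
      by (intro q_commutes_ordered_prod q_commutes_powi)
    then show "\<exists>m. q_commutes qh m (vars T t) ?Y"
      using q_commutes_sym by blast
  qed
  then obtain m' where m': "q_commutes qh m' ?Z ?Y" ..
  have YZ: "?Y * ?Z = qh powi (- m') * (?Z * ?Y)"
    using q_commutes_sym[OF m'] unfolding q_commutes_def mult.assoc .
  have "exchange_monomial * ?x = qh powi c0 * (?Y * (inverse ?x * (?Z * ?x)))"
    by (simp add: P mult.assoc)
  also have "\<dots> = qh powi c0 * (?Y * (inverse ?x * (qh powi m * (?x * ?Z))))"
    using m by (simp add: q_commutes_def mult.assoc)
  also have "\<dots> = qh powi (c0 + m) * (?Y * (inverse ?x * ?x * ?Z))"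
    by (simp only: powi_left_commute[of "inverse ?x"] powi_left_commute[of ?Y] powi_add_assoc
        mult.assoc)
  also have "\<dots> = qh powi (c0 + m) * (?Y * ?Z)"
    using assms by simp
  also have "\<dots> = qh powi (c0 + m - m') * (?Z * ?Y)"
    by (simp only: YZ powi_add_assoc) simp
  finally show ?thesis
    by blast
qed

text \<open>
  For \<open>l = 0\<close> the last factor on the right is an inverse; the two monomials in the coefficient then
  coincide, so that both sides vanish.
\<close>

lemma commutator_mutated_power:
  assumes "vars T k \<noteq> 0"
  defines "y \<equiv> vars (mutate n qh k T) k"
  shows "\<exists>g\<in>laurent_ring qh. y ^ l * vars T k - vars T k * y ^ l =
    g * ordered_prod (\<lambda>j. vars T j powi bmat T j k) (k + 1) (2 * n)
      * ordered_prod (\<lambda>j. vars T j powi bmat T j k) 1 (k - 1) * y powi (int l - 1)"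
proof -
  let ?Y = "ordered_prod (\<lambda>j. vars T j powi bmat T j k) 1 (k - 1)"
  let ?Z = "ordered_prod (\<lambda>j. vars T j powi bmat T j k) (k + 1) (2 * n)"
  obtain c where c: "exchange_monomial * vars T k = qh powi c * (?Z * ?Y)"
    using exchange_monomial_times_var[OF assms(1)] by blast
  have Px: "q_commutes qh (2 * d) exchange_monomial (vars T k)"
    using exchange_monomial_q_commutes[OF k_le] form_diagonal by simp
  let ?g = "qh powi ((int l - 1) * (2 * d) + c) - qh powi (- (2 * d) + c)"
  have "y ^ l * vars T k - vars T k * y ^ l = ?g * ?Z * ?Y * y powi (int l - 1)"
  proof (cases l)
    case 0
    then show ?thesis
      by simp
  next
    case (Suc p)
    have "y ^ l * vars T k - vars T k * y ^ l
        = (qh powi (int p * (2 * d)) - qh powi (- (2 * d))) * (qh powi c * (?Z * ?Y)) * y ^ p"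
      unfolding Suc c[symmetric]
      by (rule commutator_exchange[OF assms(1) Px]) (simp add: y_def vars_mutate_sink)
    also have "(qh powi (int p * (2 * d)) - qh powi (- (2 * d))) * (qh powi c * (?Z * ?Y))
        = ?g * (?Z * ?Y)"
    proof -
      have "(int l - 1) * (2 * d) = int p * (2 * d)"
        by (simp add: Suc)
      then show ?thesis
        by (simp only: powi_add left_diff_distrib mult.assoc)
    qed
    finally show ?thesis
      by (simp add: Suc mult.assoc)
  qed
  then show ?thesis
    using powi_diff_in_laurent_ring by blast
qed

end

section \<open>The mutation sequence through all vertices\<close>

lemma iterated_seed_Suc: "iterated_seed n qh S (Suc i) = mutate n qh (Suc i) (iterated_seed n qh S i)"
  by (simp add: iterated_seed_def)

lemma vars_iterated_seed_later:
  assumes "j > i"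
  shows "vars (iterated_seed n qh S i) j = vars S j"
  using assms
  by (induction i) (simp_all add: iterated_seed_Suc mutate_def mutate_vars_def, simp add: iterated_seed_def)

lemma vars_iterated_seed_stable:
  assumes "j \<le> i" "i \<le> i'"
  shows "vars (iterated_seed n qh S i') j = vars (iterated_seed n qh S i) j"
  using assms(2,1)
  by (induction i' rule: dec_induct) (simp_all add: iterated_seed_Suc mutate_def mutate_vars_def)

lemma quantum_torus_vars:
  assumes "quantum_torus_fractions n \<Lambda> qh X" and "skew_symmetric n \<Lambda>"
    and "i \<in> {1..2 * n}" "j \<in> {1..2 * n}"
  shows "X (unitvec i) \<noteq> 0"
    and "q_commutes qh (2 * \<Lambda> i j) (X (unitvec i)) (X (unitvec j))"
proof -
  interpret quantum_torus_fractions n \<Lambda> qh X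
    by fact
  interpret central_unit qh
    by unfold_locales (fact qh_nonzero, fact central)
  have mem: "unitvec t \<in> expvecs n" if "t \<in> {1..2 * n}" for t
    using that by (auto simp: expvecs_def unitvec_def)
  show "X (unitvec i) \<noteq> 0"
    using independent[of "{unitvec i}" "\<lambda>_. 1"] mem[OF assms(3)] one_in_laurent_ring by auto
  have prod: "X (unitvec s) * X (unitvec t) = qh powi \<Lambda> s t * X (\<lambda>u. unitvec s u + unitvec t u)"
    if "s \<in> {1..2 * n}" "t \<in> {1..2 * n}" for s t
    using mult[OF mem[OF that(1)] mem[OF that(2)]] bilin_unitvec[OF that(2), of \<Lambda> "unitvec s"]
      sum_unitvec[OF that(1)] by simp
  have sk: "\<Lambda> j i = - \<Lambda> i j"
    using assms(2-4) unfolding skew_symmetric_def by blast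
  have "qh powi (2 * \<Lambda> i j) * (X (unitvec j) * X (unitvec i))
      = qh powi (2 * \<Lambda> i j) * (qh powi (- \<Lambda> i j) * X (\<lambda>u. unitvec j u + unitvec i u))"
    by (simp only: prod[OF assms(4,3)] sk)
  also have "\<dots> = qh powi \<Lambda> i j * X (\<lambda>u. unitvec i u + unitvec j u)"
    unfolding powi_add_assoc by (simp add: add.commute)
  finally show "q_commutes qh (2 * \<Lambda> i j) (X (unitvec i)) (X (unitvec j))"
    by (simp add: q_commutes_def prod[OF assms(3,4)] mult.assoc)
qed

text \<open>
  After \<open>i\<close> mutations the indices \<open>1, \<dots>, i\<close> carry the sign \<open>- 1\<close>, and the matrix and the form are
  the initial ones conjugated by the diagonal matrix of these signs.
\<close>

definition mutated_sign :: "nat \<Rightarrow> nat \<Rightarrow> int" where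
  "mutated_sign i a = (if a \<le> i then - 1 else 1)"

lemma mutated_sign_Suc:
  "mutated_sign (Suc i) a = (if a = Suc i then - 1 else 1) * mutated_sign i a"
  by (auto simp: mutated_sign_def)

lemma mutated_sign_square: "mutated_sign i a * mutated_sign i a = 1"
  by (simp add: mutated_sign_def)

text \<open>
  The signs reverse all arrows between the mutated and the other vertices.  The next vertex in the
  order thus becomes a sink: its smaller neighbours have been mutated, its larger ones have not,
  and the nonzero entry of its column in the coefficient rows is still \<open>1\<close>.  The pairings in the
  compatibility condition are unaffected, because each summation index contributes the square of
  its sign.
\<close>

lemma sink_seed_iterated_step:
  assumes seed: "quantum_seed n d qh X S" and pc: "principal_coefficients n S"
    and order: "\<forall>i\<in>{1..n}. \<forall>j\<in>{1..n}. i > j \<longrightarrow> bmat S i j \<ge> 0"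
    and "i < n"
    and B: "\<And>a b. a \<in> {1..2 * n} \<Longrightarrow> b \<in> {1..n} \<Longrightarrow>
      bmat T a b = mutated_sign i a * mutated_sign i b * bmat S a b"
    and L: "\<And>a b. a \<in> {1..2 * n} \<Longrightarrow> b \<in> {1..2 * n} \<Longrightarrow>
      form T a b = mutated_sign i a * mutated_sign i b * form S a b"
    and V: "\<And>a b. a \<in> {1..2 * n} \<Longrightarrow> b \<in> {1..2 * n} \<Longrightarrow>
      q_commutes qh (2 * form T a b) (vars T a) (vars T b)"
  shows "sink_seed qh n (Suc i) (d (Suc i)) T"
proof -
  let ?k = "Suc i"
  have torus: "quantum_torus_fractions n (form S) qh X"
    and skew: "skew_symmetric n (form S)"
    and comp: "compatible n d (form S) (bmat S)"
    and symm: "skew_symmetrizable_by n d (bmat S)"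
    using seed by (auto simp: quantum_seed_def)
  have k: "?k \<in> {1..n}" "?k \<in> {1..2 * n}"
    using \<open>i < n\<close> by auto
  have dpos: "d a > 0" and dskew: "d a * bmat S a b = - (d b * bmat S b a)"
    if "a \<in> {1..n}" "b \<in> {1..n}" for a b
    using symm that unfolding skew_symmetrizable_by_def by blast+
  have upper: "bmat S a b \<le> 0" if "a \<in> {1..n}" "b \<in> {1..n}" "a < b" for a b
  proof -
    have "d b * bmat S b a \<ge> 0"
      using order that dpos[OF that(2,1)] by simp
    then have "d a * bmat S a b \<le> 0"
      using dskew[OF that(1,2)] by simp
    then show ?thesis
      using dpos[OF that(1,2)] by (simp add: mult_le_0_iff)
  qed
  have diag: "bmat S a a = 0" if "a \<in> {1..n}" for a
    using dskew[OF that that] dpos[OF that that] by simp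
  have coeff: "bmat S a ?k \<ge> 0" if "a \<in> {n + 1..2 * n}" for a
  proof -
    have "a = n + (a - n)" "a - n \<in> {1..n}"
      using that by auto
    then have "bmat S a ?k = (if a - n = ?k then 1 else 0)"
      using pc k(1) unfolding principal_coefficients_def by metis
    then show ?thesis
      by simp
  qed
  have row: "mutated_sign i a * bmat S ?k a \<le> 0" if "a \<in> {1..n}" for a
    using order upper[OF k(1) that] diag[OF k(1)] that k(1)
    by (cases a ?k rule: linorder_cases) (auto simp: mutated_sign_def)
  have column: "mutated_sign i a * bmat S a ?k \<ge> 0" if "a \<in> {1..2 * n}" for a
  proof (cases "a \<le> n")
    case True
    then have a: "a \<in> {1..n}"
      using that by auto
    show ?thesis
      using order upper[OF a k(1)] diag[OF k(1)] a k(1)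
      by (cases a ?k rule: linorder_cases) (auto simp: mutated_sign_def)
  next
    case False
    then show ?thesis
      using coeff[of a] that \<open>i < n\<close> by (simp add: mutated_sign_def)
  qed
  have sk: "mutated_sign i ?k = 1"
    by (simp add: mutated_sign_def)
  have skewT: "skew_symmetric n (form T)"
    unfolding skew_symmetric_def
  proof (intro ballI)
    fix a b
    assume ab: "a \<in> {1..2 * n}" "b \<in> {1..2 * n}"
    then have "form S a b = - form S b a"
      using skew unfolding skew_symmetric_def by blast
    then show "form T a b = - form T b a"
      by (simp add: L[OF ab] L[OF ab(2,1)])
  qed
  have compT: "(\<Sum>t\<in>{1..2 * n}. bmat T t ?k * form T t j) = (if j = ?k then d ?k else 0)"
    if j: "j \<in> {1..2 * n}" for j
  proof -
    have "(\<Sum>t\<in>{1..2 * n}. bmat T t ?k * form T t j)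
        = (\<Sum>t\<in>{1..2 * n}. mutated_sign i j * (bmat S t ?k * form S t j))"
    proof (rule sum.cong)
      fix t
      assume t: "t \<in> {1..2 * n}"
      have "bmat T t ?k * form T t j
          = (mutated_sign i t * mutated_sign i t) * (mutated_sign i j * (bmat S t ?k * form S t j))"
        by (simp add: B[OF t k(1)] L[OF t j] sk)
      then show "bmat T t ?k * form T t j = mutated_sign i j * (bmat S t ?k * form S t j)"
        by (simp only: mutated_sign_square mult_1)
    qed simp
    also have "\<dots> = mutated_sign i j * bilin n (form S) (\<lambda>t. bmat S t ?k) (unitvec j)"
      by (simp only: sum_distrib_left bilin_unitvec[OF j])
    also have "\<dots> = (if j = ?k then d ?k else 0)"
      using comp j k(1) sk by (auto simp: compatible_def)
    finally show ?thesis .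
  qed
  show ?thesis
  proof
    show "qh \<noteq> 0"
      by (rule quantum_torus_fractions.qh_nonzero[OF torus])
    show "qh * z = z * qh" for z
      by (rule quantum_torus_fractions.central[OF torus])
  qed (use k column row skewT compT V in \<open>simp_all add: B sk\<close>)
qed

lemma iterated_seed_signs:
  assumes seed: "quantum_seed n d qh X S" and pc: "principal_coefficients n S"
    and order: "\<forall>i\<in>{1..n}. \<forall>j\<in>{1..n}. i > j \<longrightarrow> bmat S i j \<ge> 0"
    and "i \<le> n"
  shows "(\<forall>a\<in>{1..2 * n}. \<forall>b\<in>{1..n}. bmat (iterated_seed n qh S i) a b
        = mutated_sign i a * mutated_sign i b * bmat S a b) \<and>
    (\<forall>a\<in>{1..2 * n}. \<forall>b\<in>{1..2 * n}. form (iterated_seed n qh S i) a b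
        = mutated_sign i a * mutated_sign i b * form S a b) \<and>
    (\<forall>a\<in>{1..2 * n}. \<forall>b\<in>{1..2 * n}. q_commutes qh (2 * form (iterated_seed n qh S i) a b)
        (vars (iterated_seed n qh S i) a) (vars (iterated_seed n qh S i) b))"
  using \<open>i \<le> n\<close>
proof (induction i)
  case 0
  have "iterated_seed n qh S 0 = S"
    by (simp add: iterated_seed_def)
  moreover have "q_commutes qh (2 * form S a b) (vars S a) (vars S b)"
    if "a \<in> {1..2 * n}" "b \<in> {1..2 * n}" for a b
    using seed that quantum_torus_vars(2)[of n "form S" qh X a b] by (auto simp: quantum_seed_def)
  ultimately show ?case
    by (auto simp: mutated_sign_def)
next
  case (Suc i)
  let ?T = "iterated_seed n qh S i"
  interpret sink_seed qh n "Suc i" "d (Suc i)" ?T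
    by (rule sink_seed_iterated_step[OF seed pc order]) (use Suc in auto)
  show ?case
    using Suc bmat_mutate_sink form_mutate_sink q_commutes_mutate_sink
    by (simp add: iterated_seed_Suc mutated_sign_Suc)
qed

theorem lemma4p1:
  fixes n k l :: nat
    and d :: "nat \<Rightarrow> int"
    and qh :: "'a::division_ring"
    and X :: "(nat \<Rightarrow> int) \<Rightarrow> 'a"
    and S :: "'a qseed"
  assumes "quantum_seed n d qh X S"
    and "principal_coefficients n S"
    and "acyclic_seed n S"
    and "\<forall>i\<in>{1..n}. \<forall>j\<in>{1..n}. i > j \<longrightarrow> bmat S i j \<ge> 0"
    and "k \<in> {1..n}"
  shows "\<exists>g\<in>laurent_ring qh.
    projective_var n qh S k ^ l * vars S k - vars S k * projective_var n qh S k ^ l =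
      g * ordered_prod (\<lambda>j. vars S j powi bmat S j k) (k + 1) (2 * n)
        * ordered_prod (\<lambda>j. projective_var n qh S j powi (- bmat S j k)) 1 (k - 1)
        * projective_var n qh S k powi (int l - 1)"
proof -
  obtain i where i: "k = Suc i" "i < n"
    using assms(5) by (cases k) auto
  let ?T = "iterated_seed n qh S i"
  note signs = iterated_seed_signs[OF assms(1,2,4), of i]
  have B: "bmat ?T a k = mutated_sign i a * bmat S a k" if "a \<in> {1..2 * n}" for a
    using signs that assms(5) i by (simp add: mutated_sign_def)
  interpret sink_seed qh n k "d k" ?T
    unfolding i(1) by (rule sink_seed_iterated_step[OF assms(1,2,4)]) (use signs i in auto)
  have later: "vars ?T j = vars S j" if "j \<ge> k" for j
    using that i by (intro vars_iterated_seed_later) simp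
  have earlier: "vars ?T j = projective_var n qh S j" if "j < k" for j
    unfolding projective_var_def
    by (rule vars_iterated_seed_stable[symmetric]) (use that i in auto)
  have y: "vars (mutate n qh k ?T) k = projective_var n qh S k"
    unfolding projective_var_def i(1) iterated_seed_Suc[symmetric]
    by (rule vars_iterated_seed_stable[symmetric]) (use i in auto)
  have nonzero: "vars ?T k \<noteq> 0"
    using assms(1) k_le quantum_torus_vars(1)[of n "form S" qh X k k]
    by (simp add: later quantum_seed_def)
  have sign_later: "mutated_sign i j = 1" if "j \<ge> k" for j
    using that i(1) by (simp add: mutated_sign_def)
  have sign_earlier: "mutated_sign i j = - 1" if "j < k" for j
    using that i(1) by (simp add: mutated_sign_def)
  have Z: "ordered_prod (\<lambda>j. vars ?T j powi bmat ?T j k) (k + 1) (2 * n)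
      = ordered_prod (\<lambda>j. vars S j powi bmat S j k) (k + 1) (2 * n)"
    by (rule ordered_prod_cong) (use sign_later in \<open>simp add: B later\<close>)
  have Y: "ordered_prod (\<lambda>j. vars ?T j powi bmat ?T j k) 1 (k - 1)
      = ordered_prod (\<lambda>j. projective_var n qh S j powi (- bmat S j k)) 1 (k - 1)"
    by (rule ordered_prod_cong) (use sign_earlier k in \<open>auto simp: B earlier\<close>)
  show ?thesis
    using commutator_mutated_power[OF nonzero, of l] by (simp only: Z Y y later order_refl)
qed

end
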